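(* Let $\psi:\mathcal{M}(\mathcal{X})\to\mathbb{R}$ be a functional and let $f\in\mathcal{M}(\mathcal{X})^\star$. If there exist a Young function $\phi$ and its complementary function $\phi^\star$, which admits a generalised inverse ${\phi^\star}^{-1}$, such that for every $\nu$ with $\nu(f)<+\infty$ one has $$\nu(f)\le {\phi^\star}^{-1}\big(\psi(\nu)\big),$$ then $$\psi^\star(\lambda f)\le\phi(\lambda)\quad\text{for every }\lambda>0,$$ where $\psi^\star:\mathcal{M}(\mathcal{X})^\star\to\mathbb{R}$ is the Legendre–Fenchel dual of $\psi$.
   Context: $\mathcal{M}(\mathcal{X})$ is the set of all signed measures on the space $\mathcal{X}$, and $\mathcal{M}(\mathcal{X})^\star$ is its topological dual; $\nu$ ranges over $\mathcal{M}(\mathcal{X})$. For $f\in\mathcal{M}(\mathcal{X})^\star$ and $\nu\in\mathcal{M}(\mathcal{X})$, $\nu(f)$ denotes the natural pairing of $\nu$ and $f$ (the integral of $f$ against $\nu$ when $f$ is a function). The Legendre–Fenchel dual of $\psi$ is $\psi^\star(g)=\sup_{\nu\in\mathcal{M}(\mathcal{X})}\{\nu(g)-\psi(\nu)\}$ for $g\in\mathcal{M}(\mathcal{X})^\star$. A Young function is a convex nondecreasing function $\phi:[0,\infty)\to[0,\infty)$ with $\phi(0)=0$ and $\phi(x)\to\infty$ as $x\to\infty$. Its (Young) complementary function is $\phi^\star(s)=\sup_{x>0}\{xs-\phi(x)\}$, for $s>0$. The generalised inverse of $\phi^\star$ is ${\phi^\star}^{-1}(t)=\inf\{s:\phi^\star(s)\ge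 t\}$.
   Formalization: The formal theorem also assumes ψ(ν) ≥ 0 for every ν; without it the claim fails (ψ = −1, f = 0, φ(x) = x, λ = 1/2), and the conclusion itself forces ψ ≥ 0. *)

theory Defs
  imports "HOL-Analysis.Analysis"
begin

section \<open>Signed measures and their dual space\<close>

text \<open>
  Signed measures are finite (real-valued), so that they form a vector space. Only the
  \<open>\<sigma>\<close>-algebra of \<open>M\<close> is used. Set functions vanish outside \<open>sets M\<close>, which makes equality
  of signed measures coincide with equality of HOL functions.
\<close>

definition signed_measures :: "'a measure \<Rightarrow> ('a set \<Rightarrow> real) set" where
  "signed_measures M = {\<nu>. (\<forall>A. A \<notin> sets M \<longrightarrow> \<nu> A = 0) \<and> \<nu> {} = 0 \<and>
     (\<forall>A::nat \<Rightarrow> 'a set. range A \<subseteq> sets M \<longrightarrow> disjoint_family A \<longrightarrow>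
        (\<lambda>i. \<nu> (A i)) sums \<nu> (\<Union>i. A i))}"

definition total_variation :: "'a measure \<Rightarrow> ('a set \<Rightarrow> real) \<Rightarrow> real" where
  "total_variation M \<nu> =
     (SUP P\<in>{P. finite P \<and> P \<subseteq> sets M \<and> disjoint P}. \<Sum>A\<in>P. \<bar>\<nu> A\<bar>)"

text \<open>The value off the carrier is needed because \<open>Metric_space\<close> asks for nonnegativity everywhere.\<close>

definition tv_dist :: "'a measure \<Rightarrow> ('a set \<Rightarrow> real) \<Rightarrow> ('a set \<Rightarrow> real) \<Rightarrow> real" where
  "tv_dist M \<mu> \<nu> = (if \<mu> \<in> signed_measures M \<and> \<nu> \<in> signed_measures M
     then total_variation M (\<lambda>A. \<mu> A - \<nu> A) else 0)"

text \<open>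
  Continuous linear functionals for the total variation norm. The pairing of \<open>\<nu>\<close> with \<open>f\<close>
  is the application \<open>f \<nu>\<close>. Values of \<open>f\<close> off \<open>signed_measures M\<close> are irrelevant. That
  \<open>tv_dist M\<close> is a metric there is shown in \<open>Metric_space_signed_measures\<close> below.
\<close>

definition signed_measures_dual :: "'a measure \<Rightarrow> (('a set \<Rightarrow> real) \<Rightarrow> real) set" where
  "signed_measures_dual M = {f.
     (\<forall>\<mu>\<in>signed_measures M. \<forall>\<nu>\<in>signed_measures M. \<forall>a b.
        f (\<lambda>A. a * \<mu> A + b * \<nu> A) = a * f \<mu> + b * f \<nu>) \<and>
     continuous_map (Metric_space.mtopology (signed_measures M) (tv_dist M)) euclideanreal f}"

definition legendre_fenchel_dual ::
    "'a measure \<Rightarrow> (('a set \<Rightarrow> real) \<Rightarrow> real) \<Rightarrow> (('a set \<Rightarrow> real) \<Rightarrow> real) \<Rightarrow> ereal" where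
  "legendre_fenchel_dual M \<psi> g = (SUP \<nu>\<in>signed_measures M. ereal (g \<nu> - \<psi> \<nu>))"


section \<open>Young functions\<close>

text \<open>Only the values on \<open>{0..}\<close> matter.\<close>

definition young_function :: "(real \<Rightarrow> real) \<Rightarrow> bool" where
  "young_function \<phi> \<longleftrightarrow> convex_on {0..} \<phi> \<and> mono_on {0..} \<phi> \<and> (\<forall>x\<ge>0. 0 \<le> \<phi> x) \<and>
     \<phi> 0 = 0 \<and> filterlim \<phi> at_top at_top"

text \<open>The supremum may be infinite, e.g. for \<open>\<phi> x = x\<close> and \<open>s > 1\<close>.\<close>

definition young_complement :: "(real \<Rightarrow> real) \<Rightarrow> real \<Rightarrow> ereal" where
  "young_complement \<phi> s = (SUP x\<in>{0<..}. ereal (x * s - \<phi> x))"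

text \<open>
  For \<open>h\<close> defined on \<open>(0, \<infinity>)\<close> with values in \<open>[0, \<infinity>]\<close>. Only arguments \<open>t \<ge> 0\<close> are meaningful;
  for \<open>t < 0\<close> the formula returns the junk value \<open>0\<close>.
\<close>

definition generalised_inverse :: "(real \<Rightarrow> ereal) \<Rightarrow> real \<Rightarrow> ereal" where
  "generalised_inverse h t = (INF s\<in>{s. 0 < s \<and> ereal t \<le> h s}. ereal s)"


section \<open>The total variation distance is a metric\<close>

lemma signed_measures_empty: "\<nu> \<in> signed_measures M \<Longrightarrow> \<nu> {} = 0"
  and signed_measures_outside: "\<nu> \<in> signed_measures M \<Longrightarrow> A \<notin> sets M \<Longrightarrow> \<nu> A = 0"
  and signed_measures_sums: "\<nu> \<in> signed_measures M \<Longrightarrow> range B \<subseteq> sets M \<Longrightarrow> disjoint_family B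
      \<Longrightarrow> (\<lambda>i. \<nu> (B i)) sums \<nu> (\<Union>i. B i)"
  by (auto simp: signed_measures_def)

lemma signed_measures_lincomb:
  assumes "\<mu> \<in> signed_measures M" "\<nu> \<in> signed_measures M"
  shows "(\<lambda>A. a * \<mu> A + b * \<nu> A) \<in> signed_measures M"
  using assms unfolding signed_measures_def
  by (auto intro!: sums_add sums_mult)

lemma signed_measures_diff:
  assumes "\<mu> \<in> signed_measures M" "\<nu> \<in> signed_measures M"
  shows "(\<lambda>A. \<mu> A - \<nu> A) \<in> signed_measures M"
  using signed_measures_lincomb[OF assms, of 1 "-1"] by simp

lemma signed_measures_Un:
  assumes \<nu>: "\<nu> \<in> signed_measures M" and "A \<in> sets M" "B \<in> sets M" "A \<inter> B = {}"
  shows "\<nu> (A \<union> B) = \<nu> A + \<nu> B"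
proof -
  have "range (binaryset A B) \<subseteq> sets M" "disjoint_family (binaryset A B)"
    using assms by (auto simp: range_binaryset_eq disjoint_family_on_def binaryset_def)
  from signed_measures_sums[OF \<nu> this]
  have "(\<lambda>i. \<nu> (binaryset A B i)) sums \<nu> (A \<union> B)"
    by (simp add: UN_binaryset_eq)
  moreover have "(\<lambda>i. \<nu> (binaryset A B i)) sums (\<nu> A + \<nu> B)"
    by (rule binaryset_sums) (rule signed_measures_empty[OF \<nu>])
  ultimately show ?thesis
    by (rule sums_unique2)
qed

lemma signed_measures_Diff:
  assumes "\<nu> \<in> signed_measures M" "A \<in> sets M" "B \<in> sets M" "B \<subseteq> A"
  shows "\<nu> (A - B) = \<nu> A - \<nu> B"
proof -
  have "\<nu> (B \<union> (A - B)) = \<nu> B + \<nu> (A - B)"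
    by (rule signed_measures_Un) (use assms in auto)
  moreover have "B \<union> (A - B) = A" using assms by auto
  ultimately show ?thesis by simp
qed

lemma signed_measures_Union:
  assumes \<nu>: "\<nu> \<in> signed_measures M"
  shows "finite P \<Longrightarrow> P \<subseteq> sets M \<Longrightarrow> disjoint P \<Longrightarrow> \<nu> (\<Union>P) = (\<Sum>A\<in>P. \<nu> A)"
proof (induction P rule: finite_induct)
  case empty
  then show ?case using signed_measures_empty[OF \<nu>] by simp
next
  case (insert A P)
  have "A \<inter> \<Union>P = {}"
    using insert.hyps insert.prems by (fastforce simp: pairwise_insert disjnt_def)
  moreover have "\<Union>P \<in> sets M"
    using insert by (intro sets.finite_Union) auto
  ultimately have "\<nu> (A \<union> \<Union>P) = \<nu> A + \<nu> (\<Union>P)"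
    using insert.prems by (intro signed_measures_Un[OF \<nu>]) auto
  with insert show ?case by (simp add: pairwise_insert)
qed

lemma signed_measures_decseq_convergent:
  assumes \<nu>: "\<nu> \<in> signed_measures M" and A: "range A \<subseteq> sets M" "decseq A"
  shows "convergent (\<lambda>n. \<nu> (A n))"
proof -
  define D where "D i = A i - A (Suc i)" for i
  have sub: "A (Suc i) \<subseteq> A i" for i
    using A(2) by (simp add: decseq_SucD)
  have "disjoint_family D"
    unfolding disjoint_family_on_def
  proof (intro ballI impI)
    fix m n :: nat assume "m \<noteq> n"
    then consider "Suc m \<le> n" | "Suc n \<le> m" by linarith
    then show "D m \<inter> D n = {}"
    proof cases
      case 1 then have "A n \<subseteq> A (Suc m)" using A(2) by (simp add: decseqD)
      then show ?thesis by (auto simp: D_def)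
    next
      case 2 then have "A m \<subseteq> A (Suc n)" using A(2) by (simp add: decseqD)
      then show ?thesis by (auto simp: D_def)
    qed
  qed
  moreover have "range D \<subseteq> sets M"
    using A(1) by (auto simp: D_def)
  ultimately have sm: "(\<lambda>i. \<nu> (D i)) sums \<nu> (\<Union>i. D i)"
    by (intro signed_measures_sums[OF \<nu>])
  have "\<nu> (D i) = \<nu> (A i) - \<nu> (A (Suc i))" for i
    unfolding D_def using A(1) sub by (intro signed_measures_Diff[OF \<nu>]) auto
  then have part: "(\<Sum>i<n. \<nu> (D i)) = \<nu> (A 0) - \<nu> (A n)" for n
    by (induction n) auto
  have "(\<lambda>n. \<nu> (A 0) - \<nu> (A n)) \<longlonglongrightarrow> \<nu> (\<Union>i. D i)"
    using sm by (simp add: sums_def part)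
  then have "(\<lambda>n. \<nu> (A 0) - (\<nu> (A 0) - \<nu> (A n))) \<longlonglongrightarrow> \<nu> (A 0) - \<nu> (\<Union>i. D i)"
    by (intro tendsto_intros)
  then show ?thesis
    by (auto simp: convergent_def)
qed

lemma signed_measures_bounded:
  assumes \<nu>: "\<nu> \<in> signed_measures M"
  shows "\<exists>C. \<forall>A\<in>sets M. \<bar>\<nu> A\<bar> \<le> C"
proof (rule ccontr)
  define bad where
    "bad A \<longleftrightarrow> A \<in> sets M \<and> (\<forall>C. \<exists>B\<in>sets M. B \<subseteq> A \<and> C < \<bar>\<nu> B\<bar>)" for A
  assume "\<nexists>C. \<forall>A\<in>sets M. \<bar>\<nu> A\<bar> \<le> C"
  then have bad_space: "bad (space M)"
    unfolding bad_def by (metis not_le sets.sets_into_space sets.top)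
  have step: "\<exists>B. bad B \<and> B \<subseteq> A \<and> real n \<le> \<bar>\<nu> B\<bar>" if bad: "bad A" for A n
  proof -
    obtain B where B: "B \<in> sets M" "B \<subseteq> A" "\<bar>\<nu> A\<bar> + real n < \<bar>\<nu> B\<bar>"
      using bad unfolding bad_def by blast
    have A: "A \<in> sets M" using bad by (simp add: bad_def)
    have "\<nu> (A - B) = \<nu> A - \<nu> B"
      by (rule signed_measures_Diff[OF \<nu> A B(1,2)])
    then have large: "real n \<le> \<bar>\<nu> B\<bar>" "real n \<le> \<bar>\<nu> (A - B)\<bar>"
      using B(3) by linarith+
    have "bad B \<or> bad (A - B)"
    proof (rule ccontr)
      assume "\<not> (bad B \<or> bad (A - B))"
      then obtain C1 C2 where
        C1: "\<And>C. C \<in> sets M \<Longrightarrow> C \<subseteq> B \<Longrightarrow> \<bar>\<nu> C\<bar> \<le> C1" and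
        C2: "\<And>C. C \<in> sets M \<Longrightarrow> C \<subseteq> A - B \<Longrightarrow> \<bar>\<nu> C\<bar> \<le> C2"
        using A B(1) unfolding bad_def by (meson not_le sets.Diff)
      obtain C where C: "C \<in> sets M" "C \<subseteq> A" "C1 + C2 < \<bar>\<nu> C\<bar>"
        using bad unfolding bad_def by blast
      have "\<nu> (C \<inter> B \<union> (C - B)) = \<nu> (C \<inter> B) + \<nu> (C - B)"
        by (rule signed_measures_Un[OF \<nu>]) (use C B in auto)
      moreover have "C \<inter> B \<union> (C - B) = C" by auto
      moreover have "\<bar>\<nu> (C \<inter> B)\<bar> \<le> C1" by (rule C1) (use C B in auto)
      moreover have "\<bar>\<nu> (C - B)\<bar> \<le> C2" by (rule C2) (use C B in auto)
      ultimately show False using C(3) by simp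
    qed
    then show ?thesis using large B(2) by blast
  qed
  obtain A where A: "\<And>n. bad (A n)" "\<And>n. A (Suc n) \<subseteq> A n \<and> real n \<le> \<bar>\<nu> (A (Suc n))\<bar>"
    using dependent_nat_choice[where P = "\<lambda>_ A. bad A"
        and Q = "\<lambda>n A B. B \<subseteq> A \<and> real n \<le> \<bar>\<nu> B\<bar>"] bad_space step
    by metis
  have "convergent (\<lambda>n. \<nu> (A n))"
    using A by (intro signed_measures_decseq_convergent[OF \<nu>])
      (auto simp: bad_def decseq_Suc_iff)
  then obtain K where K: "\<And>n. \<bar>\<nu> (A n)\<bar> \<le> K"
    unfolding real_norm_def[symmetric] by (meson BseqE convergent_imp_Bseq)
  obtain n where "K < real n" using reals_Archimedean2 by blast
  then show False using A(2)[of n] K[of "Suc n"] by linarith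
qed

lemma bdd_above_total_variation:
  assumes \<nu>: "\<nu> \<in> signed_measures M"
  shows "bdd_above ((\<lambda>P. \<Sum>A\<in>P. \<bar>\<nu> A\<bar>) ` {P. finite P \<and> P \<subseteq> sets M \<and> disjoint P})"
proof -
  obtain C where C: "\<And>A. A \<in> sets M \<Longrightarrow> \<bar>\<nu> A\<bar> \<le> C"
    using signed_measures_bounded[OF \<nu>] by blast
  have "(\<Sum>A\<in>P. \<bar>\<nu> A\<bar>) \<le> 2 * C" if P: "finite P" "P \<subseteq> sets M" "disjoint P" for P
  proof -
    define Q where "Q = {A\<in>P. 0 \<le> \<nu> A}"
    have Q: "finite Q" "Q \<subseteq> sets M" "disjoint Q" "Q \<subseteq> P"
      and R: "finite (P - Q)" "P - Q \<subseteq> sets M" "disjoint (P - Q)"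
      using P by (auto simp: Q_def pairwise_def)
    have "(\<Sum>A\<in>P. \<bar>\<nu> A\<bar>) = (\<Sum>A\<in>P - Q. \<bar>\<nu> A\<bar>) + (\<Sum>A\<in>Q. \<bar>\<nu> A\<bar>)"
      using P Q by (intro sum.subset_diff) auto
    also have "(\<Sum>A\<in>P - Q. \<bar>\<nu> A\<bar>) = (\<Sum>A\<in>P - Q. - \<nu> A)"
      by (rule sum.cong) (auto simp: Q_def)
    also have "\<dots> = - \<nu> (\<Union>(P - Q))"
      using signed_measures_Union[OF \<nu> R] by (simp add: sum_negf)
    also have "(\<Sum>A\<in>Q. \<bar>\<nu> A\<bar>) = (\<Sum>A\<in>Q. \<nu> A)"
      by (rule sum.cong) (auto simp: Q_def)
    also have "\<dots> = \<nu> (\<Union>Q)"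
      using signed_measures_Union[OF \<nu> Q(1-3)] by simp
    finally have eq: "(\<Sum>A\<in>P. \<bar>\<nu> A\<bar>) = - \<nu> (\<Union>(P - Q)) + \<nu> (\<Union>Q)" .
    have "\<bar>\<nu> (\<Union>(P - Q))\<bar> \<le> C" "\<bar>\<nu> (\<Union>Q)\<bar> \<le> C"
      using Q R by (auto intro!: C sets.finite_Union)
    with eq show ?thesis by linarith
  qed
  then show ?thesis by (intro bdd_aboveI2) auto
qed

lemma sum_le_total_variation:
  assumes "\<nu> \<in> signed_measures M" "finite P" "P \<subseteq> sets M" "disjoint P"
  shows "(\<Sum>A\<in>P. \<bar>\<nu> A\<bar>) \<le> total_variation M \<nu>"
  unfolding total_variation_def
  using assms by (intro cSUP_upper bdd_above_total_variation) auto

lemma total_variation_least: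
  assumes "\<And>P. finite P \<Longrightarrow> P \<subseteq> sets M \<Longrightarrow> disjoint P \<Longrightarrow> (\<Sum>A\<in>P. \<bar>\<nu> A\<bar>) \<le> C"
  shows "total_variation M \<nu> \<le> C"
  unfolding total_variation_def
proof (rule cSUP_least)
  show "{P. finite P \<and> P \<subseteq> sets M \<and> disjoint P} \<noteq> {}"
    using pairwise_empty by blast
qed (use assms in blast)

lemma abs_le_total_variation:
  assumes "\<nu> \<in> signed_measures M"
  shows "\<bar>\<nu> A\<bar> \<le> total_variation M \<nu>"
proof (cases "A \<in> sets M")
  case True
  then show ?thesis
    using sum_le_total_variation[OF assms, of "{A}"] by simp
next
  case False
  then show ?thesis
    using sum_le_total_variation[OF assms, of "{}"] signed_measures_outside[OF assms] by simp
qed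

lemma Metric_space_signed_measures: "Metric_space (signed_measures M) (tv_dist M)"
proof
  fix \<mu> \<nu> :: "'a set \<Rightarrow> real"
  show "0 \<le> tv_dist M \<mu> \<nu>"
    using order_trans[OF abs_ge_zero abs_le_total_variation[OF signed_measures_diff]]
    unfolding tv_dist_def by simp blast
  show "tv_dist M \<mu> \<nu> = tv_dist M \<nu> \<mu>"
    by (simp add: tv_dist_def total_variation_def abs_minus_commute conj_commute)
next
  fix \<mu> \<nu> assume \<mu>: "\<mu> \<in> signed_measures M" and \<nu>: "\<nu> \<in> signed_measures M"
  note d = signed_measures_diff[OF \<mu> \<nu>]
  show "tv_dist M \<mu> \<nu> = 0 \<longleftrightarrow> \<mu> = \<nu>"
  proof
    assume "tv_dist M \<mu> \<nu> = 0"
    then show "\<mu> = \<nu>"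
      using abs_le_total_variation[OF d] \<mu> \<nu> by (simp add: tv_dist_def fun_eq_iff)
  next
    assume "\<mu> = \<nu>"
    then show "tv_dist M \<mu> \<nu> = 0"
      using total_variation_least[of M "\<lambda>A. \<mu> A - \<nu> A" 0]
        order_trans[OF abs_ge_zero abs_le_total_variation[OF d]] \<mu>
      by (simp add: tv_dist_def)
  qed
next
  fix \<mu> \<nu> \<rho>
  assume \<mu>: "\<mu> \<in> signed_measures M" and \<nu>: "\<nu> \<in> signed_measures M"
    and \<rho>: "\<rho> \<in> signed_measures M"
  show "tv_dist M \<mu> \<rho> \<le> tv_dist M \<mu> \<nu> + tv_dist M \<nu> \<rho>"
  proof -
    have "total_variation M (\<lambda>A. \<mu> A - \<rho> A)
        \<le> total_variation M (\<lambda>A. \<mu> A - \<nu> A) + total_variation M (\<lambda>A. \<nu> A - \<rho> A)"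
    proof (rule total_variation_least)
      fix P assume P: "finite P" "P \<subseteq> sets M" "disjoint P"
      have "(\<Sum>A\<in>P. \<bar>\<mu> A - \<rho> A\<bar>) \<le> (\<Sum>A\<in>P. \<bar>\<mu> A - \<nu> A\<bar>) + (\<Sum>A\<in>P. \<bar>\<nu> A - \<rho> A\<bar>)"
        unfolding sum.distrib[symmetric] by (rule sum_mono) linarith
      also have "\<dots> \<le> total_variation M (\<lambda>A. \<mu> A - \<nu> A) + total_variation M (\<lambda>A. \<nu> A - \<rho> A)"
        using sum_le_total_variation[OF signed_measures_diff[OF \<mu> \<nu>] P]
          sum_le_total_variation[OF signed_measures_diff[OF \<nu> \<rho>] P] by linarith
      finally show "(\<Sum>A\<in>P. \<bar>\<mu> A - \<rho> A\<bar>)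
          \<le> total_variation M (\<lambda>A. \<mu> A - \<nu> A) + total_variation M (\<lambda>A. \<nu> A - \<rho> A)" .
    qed
    then show ?thesis using \<mu> \<nu> \<rho> by (simp add: tv_dist_def)
  qed
qed

end

theory Submission
  imports Defs
begin

text \<open>For \<open>f \<nu> > 0\<close>, each \<open>s\<close> in \<open>(0, f \<nu>)\<close>
  lies below the infimum defining the generalised inverse at \<open>\<psi> \<nu>\<close>, so the
  complement at \<open>s\<close> is less than \<open>\<psi> \<nu>\<close>. Young's inequality then
  bounds \<open>lam * s - \<phi> lam\<close> by \<open>\<psi> \<nu>\<close>, and \<open>s\<close>
  may increase to \<open>f \<nu>\<close>: this is
  \<open>young_inequality_generalised_inverse\<close>. The supremum over \<open>\<nu>\<close> gives
  the claim.\<close>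

lemma less_if_less_generalised_inverse:
  assumes "0 < s" "ereal s < generalised_inverse h t"
  shows "h s < ereal t"
proof (rule ccontr)
  assume "\<not> h s < ereal t"
  then have "generalised_inverse h t \<le> ereal s"
    unfolding generalised_inverse_def using assms(1) by (intro INF_lower) auto
  with assms(2) show False by simp
qed

text \<open>The Young inequality is applied at \<open>s < y\<close> and passed to the limit, since the complement
  may exceed \<open>t\<close>, or be infinite, at \<open>y\<close> itself.\<close>

lemma young_inequality_generalised_inverse:
  assumes "0 < x" "0 < y" and le: "ereal y \<le> generalised_inverse (young_complement \<phi>) t"
  shows "x * y - \<phi> x \<le> t"
proof -
  have "x * s - \<phi> x \<le> t" if "0 < s" "s < y" for s
  proof -
    have "ereal (x * s - \<phi> x) \<le> young_complement \<phi> s"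
      unfolding young_complement_def using assms(1) by (intro SUP_upper) auto
    also have "\<dots> < ereal t"
      using that le by (intro less_if_less_generalised_inverse)
        (auto intro: less_le_trans[of _ "ereal y"])
    finally show ?thesis by simp
  qed
  \<comment> \<open>Isolating \<open>s\<close> gives a bound independent of \<open>s\<close>, which
    by density passes to \<open>y\<close>.\<close>
  then have "s \<le> (t + \<phi> x) / x" if "0 < s" "s < y" for s
    using that assms(1) by (simp add: field_simps)
  then have "y \<le> (t + \<phi> x) / x"
    using assms(2) by (rule dense_le_bounded[rotated])
  then show ?thesis
    using assms(1) by (simp add: field_simps)
qed

theorem theorem2:
  fixes M :: "'a measure"
    and \<psi> f :: "('a set \<Rightarrow> real) \<Rightarrow> real"
    and \<phi> :: "real \<Rightarrow> real"
  assumes "f \<in> signed_measures_dual M"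
    and "young_function \<phi>"
    and "\<forall>\<nu>\<in>signed_measures M. ereal (f \<nu>) < \<infinity> \<longrightarrow>
           0 \<le> \<psi> \<nu> \<and> ereal (f \<nu>) \<le> generalised_inverse (young_complement \<phi>) (\<psi> \<nu>)"
  shows "\<forall>lam>0. legendre_fenchel_dual M \<psi> (\<lambda>\<nu>. lam * f \<nu>) \<le> ereal (\<phi> lam)"
proof (intro allI impI)
  fix lam :: real
  assume lam: "0 < lam"
  have "lam * f \<nu> - \<psi> \<nu> \<le> \<phi> lam" if \<nu>: "\<nu> \<in> signed_measures M" for \<nu>
  \<comment> \<open>The complement is considered only at positive arguments, so Young's inequality
    serves positive \<open>f \<nu>\<close>; otherwise the signs of \<open>lam * f \<nu>\<close>,
    \<open>\<psi> \<nu>\<close> and \<open>\<phi> lam\<close> suffice.\<close>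
  proof (cases "0 < f \<nu>")
    case True
    then show ?thesis
      using young_inequality_generalised_inverse[OF lam True] assms(3) \<nu> by force
  next
    case False
    then have "lam * f \<nu> \<le> 0"
      using lam by (simp add: mult_nonneg_nonpos)
    moreover have "0 \<le> \<psi> \<nu>" "0 \<le> \<phi> lam"
      using assms(2,3) \<nu> lam by (auto simp: young_function_def)
    ultimately show ?thesis by linarith
  qed
  then show "legendre_fenchel_dual M \<psi> (\<lambda>\<nu>. lam * f \<nu>) \<le> ereal (\<phi> lam)"
    unfolding legendre_fenchel_dual_def by (intro SUP_least) simp
qed

end
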